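(* Let $G$ be an equitably 3-colorable graph on $n\ge 2$ vertices and let $l\ge 1$. If $m\in\{2,3,5\}$, then $\chi_{=}(G\circ^l P_m)=3$.
   Context: All graphs are finite, simple and connected. $P_m$ denotes the path on $m$ vertices. A graph is equitably $k$-colorable if its vertex set can be partitioned into $k$ (possibly empty) independent sets $V_1,\dots,V_k$ with $||V_i|-|V_j||\le 1$ for all $i,j$; $\chi_{=}(G)$ is the least $k$ for which $G$ is equitably $k$-colorable. The corona $G\circ H$ is formed from one copy of $G$ and $|V(G)|$ copies of $H$, the $i$-th vertex of $G$ being joined to every vertex of the $i$-th copy of $H$; $G\circ^1 H=G\circ H$ and $G\circ^l H=(G\circ^{l-1}H)\circ H$ for $l\ge 2$. *)

theory Defs
  imports "Graph_Theory.Graph_Theory" "HOL-Library.Disjoint_Sets"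
begin

text \<open>
  A finite simple graph is a \<^locale>\<open>pair_graph\<close>: finite, loop-free, and with the symmetric
  arc relation that contains both orientations of every edge.
\<close>

definition independent_set :: "'a pair_pre_digraph \<Rightarrow> 'a set \<Rightarrow> bool" where
  "independent_set G S \<longleftrightarrow> S \<subseteq> pverts G \<and> (\<forall>u\<in>S. \<forall>v\<in>S. (u, v) \<notin> parcs G)"

text \<open>The colour classes \<open>V 0, \<dots>, V (k - 1)\<close> may be empty.\<close>

definition equitably_colorable :: "nat \<Rightarrow> 'a pair_pre_digraph \<Rightarrow> bool" where
  "equitably_colorable k G \<longleftrightarrow>
    (\<exists>V :: nat \<Rightarrow> 'a set.
      (\<Union>i<k. V i) = pverts G \<and> disjoint_family_on V {..<k} \<and>
      (\<forall>i<k. independent_set G (V i)) \<and>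
      (\<forall>i<k. \<forall>j<k. \<bar>int (card (V i)) - int (card (V j))\<bar> \<le> 1))"

definition equitable_chromatic_number :: "'a pair_pre_digraph \<Rightarrow> nat" where
  "equitable_chromatic_number G = (LEAST k. equitably_colorable k G)"

definition path_graph :: "nat \<Rightarrow> nat pair_pre_digraph" where
  "path_graph m =
    \<lparr> pverts = {..<m},
      parcs = {(i, j). i < m \<and> j < m \<and> (j = Suc i \<or> i = Suc j)} \<rparr>"

text \<open>
  The vertex \<open>(v, None)\<close> is the vertex \<open>v\<close> of \<open>G\<close>; the vertices \<open>(v, Some x)\<close> form the copy of
  \<open>H\<close> attached to \<open>v\<close>.
\<close>

definition corona ::
    "'a pair_pre_digraph \<Rightarrow> 'b pair_pre_digraph \<Rightarrow> ('a \<times> 'b option) pair_pre_digraph" where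
  "corona G H =
    \<lparr> pverts = pverts G \<times> insert None (Some ` pverts H),
      parcs =
        {((u, None), (v, None)) | u v. (u, v) \<in> parcs G} \<union>
        {((v, Some x), (v, Some y)) | v x y. v \<in> pverts G \<and> (x, y) \<in> parcs H} \<union>
        {((v, None), (v, Some x)) | v x. v \<in> pverts G \<and> x \<in> pverts H} \<union>
        {((v, Some x), (v, None)) | v x. v \<in> pverts G \<and> x \<in> pverts H} \<rparr>"

definition relabel :: "('a \<Rightarrow> 'b) \<Rightarrow> 'a pair_pre_digraph \<Rightarrow> 'b pair_pre_digraph" where
  "relabel f G = \<lparr> pverts = f ` pverts G, parcs = map_prod f f ` parcs G \<rparr>"

text \<open>
  Each corona changes the vertex type. To iterate it, the nested pairs
  \<open>(\<dots>((v, y\<^sub>1), y\<^sub>2) \<dots>, y\<^sub>l)\<close> are relabelled injectively as \<open>(v, [y\<^sub>l, \<dots>, y\<^sub>1])\<close>.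
\<close>

primrec iterated_corona ::
    "'a pair_pre_digraph \<Rightarrow> nat \<Rightarrow> 'b pair_pre_digraph \<Rightarrow> ('a \<times> 'b option list) pair_pre_digraph"
where
  "iterated_corona G 0 H = relabel (\<lambda>v. (v, [])) G"
| "iterated_corona G (Suc l) H =
    relabel (\<lambda>((v, ys), y). (v, y # ys)) (corona (iterated_corona G l H) H)"

lemma pair_graph_iff:
  "pair_graph G \<longleftrightarrow> finite (pverts G) \<and> parcs G \<subseteq> pverts G \<times> pverts G \<and> sym (parcs G) \<and> irrefl (parcs G)"
  (is "?L \<longleftrightarrow> ?R")
proof
  assume ?L
  then interpret pair_graph G .
  show ?R
    using pair_finite_verts arc_fst_in_verts arc_snd_in_verts pair_sym_arcs pair_no_loops
    by (fastforce simp: symmetric_def irrefl_def)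
next
  assume R: ?R
  then have "finite (parcs G)"
    by (meson finite_SigmaI finite_subset)
  with R show ?L
    by unfold_locales (auto simp: symmetric_def irrefl_def)
qed

lemma pair_graph_path_graph: "pair_graph (path_graph m)"
  by (auto simp: pair_graph_iff path_graph_def sym_def irrefl_def)

lemma pair_graph_corona:
  assumes "pair_graph G" "pair_graph H"
  shows "pair_graph (corona G H)"
  using assms unfolding pair_graph_iff corona_def
  by (fastforce simp: sym_def irrefl_def)

lemma pair_graph_relabel:
  assumes "pair_graph G" "inj f"
  shows "pair_graph (relabel f G)"
  using assms unfolding pair_graph_iff relabel_def
  by (fastforce simp: sym_def irrefl_def inj_eq)

lemma inj_flatten: "inj (\<lambda>((v, ys), y). (v, y # ys))"
  by (auto simp: inj_def)

lemma pair_graph_iterated_corona: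
  assumes "pair_graph G" "pair_graph H"
  shows "pair_graph (iterated_corona G l H)"
  by (induction l)
    (use assms in \<open>auto intro!: pair_graph_relabel pair_graph_corona inj_flatten simp: inj_def\<close>)

lemma card_iterated_corona:
  assumes "finite (pverts H)"
  shows "card (pverts (iterated_corona G l H)) = card (pverts G) * Suc (card (pverts H)) ^ l"
proof (induction l)
  case 0
  show ?case by (simp add: relabel_def card_image inj_on_def)
next
  case (Suc l)
  have "card (insert None (Some ` pverts H)) = Suc (card (pverts H))"
    using assms by (subst card_insert_disjoint) (auto simp: card_image)
  then show ?case
    using Suc by (simp add: relabel_def corona_def card_image inj_on_subset[OF inj_flatten]
        card_cartesian_product algebra_simps)
qed

end

theory Submission
  imports Defs
begin

text \<open>
  A corona with a path on at least two vertices contains a triangle, so three colours are needed.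
  Conversely let \<open>c\<close> be an equitable 3-colouring of a graph on \<open>n \<ge> 2\<close> vertices. No class has more
  than \<open>n / 2\<close> vertices, so some permutation \<open>\<pi>\<close> of the vertices changes every colour. Colour the
  path at \<open>v\<close> alternately with \<open>c (\<pi> v)\<close>, which comes first, and with the third colour. As \<open>\<pi>\<close>
  permutes the vertices, a class of size \<open>s\<close> becomes one of size
  \<open>s + \<lceil>m / 2\<rceil> s + \<lfloor>m / 2\<rfloor> (n - 2 s)\<close>, and here the coefficient \<open>1 + \<lceil>m / 2\<rceil> - 2 \<lfloor>m / 2\<rfloor>\<close> of
  \<open>s\<close> is \<open>0\<close>, \<open>1\<close>, \<open>0\<close> for \<open>m = 2, 3, 5\<close>, so the new colouring is equitable and can be extended
  again.
\<close>

section \<open>Colour functions, relabelling and triangles\<close>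

text \<open>Colourings are built and counted as functions below. Since \<open>i\<close> and
  \<open>j\<close> range over all ordered pairs, a one-sided bound in the naturals replaces the
  absolute value.\<close>

lemma equitably_colorable_iff:
  assumes "pair_graph G"
  shows "equitably_colorable k G \<longleftrightarrow>
    (\<exists>c. (\<forall>v\<in>pverts G. c v < k) \<and> (\<forall>(u, v)\<in>parcs G. c u \<noteq> c v) \<and>
      (\<forall>i<k. \<forall>j<k. card {v \<in> pverts G. c v = i} \<le> Suc (card {v \<in> pverts G. c v = j})))"
    (is "?L \<longleftrightarrow> (\<exists>c. ?R c)")
proof
  assume ?L
  then obtain V :: "nat \<Rightarrow> 'a set" where V: "(\<Union>i<k. V i) = pverts G"
    "disjoint_family_on V {..<k}" "\<forall>i<k. independent_set G (V i)"
    "\<forall>i<k. \<forall>j<k. \<bar>int (card (V i)) - int (card (V j))\<bar> \<le> 1"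
    unfolding equitably_colorable_def by blast
  define c where "c v = (SOME i. i < k \<and> v \<in> V i)" for v
  have c: "c v < k \<and> v \<in> V (c v)" if "v \<in> pverts G" for v
  proof -
    have "\<exists>i. i < k \<and> v \<in> V i"
      using that V(1) by blast
    then show ?thesis
      unfolding c_def by (rule someI_ex)
  qed
  have "c v = i" if "v \<in> V i" "i < k" for v i
  proof -
    have "v \<in> pverts G" using that V(1) by blast
    with c[of v] that V(2) show ?thesis
      unfolding disjoint_family_on_def by blast
  qed
  then have class_eq: "{v \<in> pverts G. c v = i} = V i" if "i < k" for i
    using that c V(1) by auto
  have "c u \<noteq> c v" if "(u, v) \<in> parcs G" for u v
  proof -
    have "u \<in> pverts G" "v \<in> pverts G"
      using that assms by (auto simp: pair_graph_iff)
    then show ?thesis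
      using c[of u] c[of v] V(3) that unfolding independent_set_def by metis
  qed
  moreover have "card (V i) \<le> Suc (card (V j))" if "i < k" "j < k" for i j
    using V(4) that by (smt (verit, best) of_nat_Suc of_nat_le_iff)
  ultimately have "?R c"
    using c class_eq by auto
  then show "\<exists>c. ?R c"
    by (rule exI[of _ c])
next
  assume "\<exists>c. ?R c"
  then obtain c where c: "?R c" ..
  show ?L
    unfolding equitably_colorable_def
  proof (intro exI[of _ "\<lambda>i. {v \<in> pverts G. c v = i}"] conjI allI impI)
    fix i j assume "i < k" "j < k"
    then have "card {v \<in> pverts G. c v = i} \<le> Suc (card {v \<in> pverts G. c v = j})"
      "card {v \<in> pverts G. c v = j} \<le> Suc (card {v \<in> pverts G. c v = i})"
      using c by blast+
    then show "\<bar>int (card {v \<in> pverts G. c v = i}) - int (card {v \<in> pverts G. c v = j})\<bar> \<le> 1"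
      by linarith
  qed (use c in \<open>auto simp: disjoint_family_on_def independent_set_def\<close>)
qed

text \<open>Carries colourings through the flattening in \<open>iterated_corona\<close>; injectivity
  keeps the classes disjoint, independent and of the same size.\<close>

lemma equitably_colorable_relabel:
  assumes "inj f" "equitably_colorable k G"
  shows "equitably_colorable k (relabel f G)"
proof -
  obtain V :: "nat \<Rightarrow> 'a set" where V: "(\<Union>i<k. V i) = pverts G"
    "disjoint_family_on V {..<k}" "\<forall>i<k. independent_set G (V i)"
    "\<forall>i<k. \<forall>j<k. \<bar>int (card (V i)) - int (card (V j))\<bar> \<le> 1"
    using assms(2) unfolding equitably_colorable_def by blast
  show ?thesis
    unfolding equitably_colorable_def
  proof (intro exI[of _ "\<lambda>i. f ` V i"] conjI)
    show "(\<Union>i<k. f ` V i) = pverts (relabel f G)"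
      by (simp add: relabel_def flip: V(1) image_UN)
    show "disjoint_family_on (\<lambda>i. f ` V i) {..<k}"
      using V(2) assms(1) by (simp add: disjoint_family_on_def flip: image_Int)
    show "\<forall>i<k. independent_set (relabel f G) (f ` V i)"
      using V(3) assms(1) by (fastforce simp: independent_set_def relabel_def inj_eq)
    show "\<forall>i<k. \<forall>j<k. \<bar>int (card (f ` V i)) - int (card (f ` V j))\<bar> \<le> 1"
      using V(4) assms(1) by (simp add: card_image inj_on_subset)
  qed
qed

lemma colors_ge_3_if_triangle:
  assumes "pair_graph G" "equitably_colorable k G"
    and "(u, v) \<in> parcs G" "(v, w) \<in> parcs G" "(u, w) \<in> parcs G"
  shows "3 \<le> k"
proof -
  obtain c where c: "\<forall>v\<in>pverts G. c v < k" "\<forall>(u, v)\<in>parcs G. c u \<noteq> c v"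
    using assms(2) unfolding equitably_colorable_iff[OF assms(1)] by blast
  have "u \<in> pverts G" "v \<in> pverts G" "w \<in> pverts G"
    using assms by (auto simp: pair_graph_iff)
  then have "{c u, c v, c w} \<subseteq> {..<k}"
    using c(1) by auto
  then have "card {c u, c v, c w} \<le> k"
    using card_mono[OF finite_lessThan] by fastforce
  moreover have "c u \<noteq> c v" "c v \<noteq> c w" "c u \<noteq> c w"
    using c(2) assms(3-5) by blast+
  then have "card {c u, c v, c w} = 3"
    by simp
  ultimately show ?thesis by simp
qed

section \<open>A permutation that changes every colour\<close>

text \<open>List \<open>A\<close> in the order of its values and rotate by half the length: a block
  of equal values fills at most half of the list, so no entry lands in its own block.\<close>

lemma ex_permutation_changing_values:
  fixes c :: "'a \<Rightarrow> 'b::linorder"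
  assumes "finite A" and half: "\<And>i. 2 * card {a \<in> A. c a = i} \<le> card A"
  shows "\<exists>\<pi>. bij_betw \<pi> A A \<and> (\<forall>a\<in>A. c (\<pi> a) \<noteq> c a)"
proof -
  obtain ys where ys: "set ys = A" "distinct ys"
    using finite_distinct_list[OF assms(1)] by blast
  define xs where "xs = sort_key c ys"
  define n where "n = length xs"
  define h where "h = n div 2"
  \<comment> \<open>On positions below \<open>n\<close> this is addition of \<open>h\<close> modulo
    \<open>n\<close>, split into cases to stay within linear arithmetic.\<close>
  define s where "s i = (if i + h < n then i + h else i + h - n)" for i
  have xs: "set xs = A" "distinct xs" and srt: "sorted (map c xs)"
    using ys by (auto simp: xs_def)
  have n: "n = card A"
    using xs distinct_card n_def by fastforce
  have idx: "bij_betw ((!) xs) {..<n} A"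
    using bij_betw_nth[OF xs(2)] xs(1) n_def by blast
  have "inj_on s {..<n}"
    by (auto simp: inj_on_def s_def h_def split: if_splits)
  moreover have "s ` {..<n} \<subseteq> {..<n}"
    by (auto simp: s_def h_def)
  ultimately have bij_s: "bij_betw s {..<n} {..<n}"
    by (simp add: bij_betw_def endo_inj_surj)
  \<comment> \<open>Equal values occupy consecutive positions of the sorted list, hence fewer than \<open>h + 1\<close> of
    them, while the cyclic shift by \<open>h\<close> moves every position by at least \<open>h\<close>.\<close>
  have close: "j - i < h" if "i < j" "j < n" "c (xs ! i) = c (xs ! j)" for i j
  proof -
    have "c (xs ! k) = c (xs ! i)" if k: "k \<in> {i..j}" for k
    proof (rule antisym)
      show "c (xs ! k) \<le> c (xs ! i)"
        using sorted_nth_mono[OF srt, of k j] k that \<open>j < n\<close> \<open>c (xs ! i) = c (xs ! j)\<close> n_def by simp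
      show "c (xs ! i) \<le> c (xs ! k)"
        using sorted_nth_mono[OF srt, of i k] k \<open>j < n\<close> n_def by simp
    qed
    moreover have "xs ! k \<in> A" if "k \<in> {i..j}" for k
      using that \<open>j < n\<close> xs(1) n_def by auto
    ultimately have "(!) xs ` {i..j} \<subseteq> {a \<in> A. c a = c (xs ! i)}"
      by blast
    then have "card ((!) xs ` {i..j}) \<le> card {a \<in> A. c a = c (xs ! i)}"
      using assms(1) by (intro card_mono) auto
    moreover have "inj_on ((!) xs) {i..j}"
      using that by (intro inj_on_subset[OF bij_betw_imp_inj_on[OF idx]]) auto
    ultimately have "Suc j - i \<le> card {a \<in> A. c a = c (xs ! i)}"
      by (simp add: card_image)
    moreover have "card {a \<in> A. c a = c (xs ! i)} \<le> h"
      using half[of "c (xs ! i)"] n h_def by linarith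
    ultimately show ?thesis
      using \<open>i < j\<close> by linarith
  qed
  have moved: "c (xs ! s i) \<noteq> c (xs ! i)" if "i < n" for i
  proof
    assume eq: "c (xs ! s i) = c (xs ! i)"
    \<comment> \<open>A nonempty class with at most \<open>n div 2\<close> elements forces
      \<open>h\<close> to be positive, so the shift is not the identity.\<close>
    have "{xs ! i} \<subseteq> {a \<in> A. c a = c (xs ! i)}"
      using that xs(1) n_def by auto
    then have "card {xs ! i} \<le> card {a \<in> A. c a = c (xs ! i)}"
      using assms(1) by (intro card_mono) auto
    then have "h > 0"
      using half[of "c (xs ! i)"] n h_def by simp
    show False
    proof (cases "i + h < n")
      case True
      then have "s i = i + h" by (simp add: s_def)
      then show False using close[of i "s i"] True eq \<open>h > 0\<close> by simp
    next
      case False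
      \<comment> \<open>A position that wraps around moves down by \<open>n - h\<close>, which is at
        least \<open>h\<close> for odd \<open>n\<close> too.\<close>
      have "2 * h \<le> n" by (simp add: h_def)
      moreover have "s i = i + h - n"
        using False by (simp add: s_def)
      ultimately show False
        using close[of "s i" i] False that eq \<open>h > 0\<close> by linarith
    qed
  qed
  define p where "p = the_inv_into {..<n} ((!) xs)"
  define \<pi> where "\<pi> = (!) xs \<circ> s \<circ> p"
  have p: "bij_betw p A {..<n}"
    unfolding p_def using idx by (rule bij_betw_the_inv_into)
  have "bij_betw \<pi> A A"
    unfolding \<pi>_def using p bij_s idx by (blast intro: bij_betw_trans)
  moreover have "c (\<pi> a) \<noteq> c a" if "a \<in> A" for a
  proof -
    have "p a < n" using p that by (auto simp: bij_betw_def)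
    moreover have "xs ! p a = a"
      unfolding p_def using idx that by (rule f_the_inv_into_f_bij_betw)
    ultimately show ?thesis
      using moved[of "p a"] by (simp add: \<pi>_def)
  qed
  ultimately show ?thesis by blast
qed

section \<open>Extending a colouring to one corona\<close>

lemma card_even_less: "card {x. x < m \<and> even x} = Suc m div 2"
  and card_odd_less: "card {x. x < m \<and> odd x} = m div 2"
proof (induction m)
  case (Suc m)
  have "{x. x < Suc m \<and> even x} =
      (if even m then insert m {x. x < m \<and> even x} else {x. x < m \<and> even x})"
    "{x. x < Suc m \<and> odd x} =
      (if odd m then insert m {x. x < m \<and> odd x} else {x. x < m \<and> odd x})"
    by (auto simp: less_Suc_eq)
  then show "card {x. x < Suc m \<and> even x} = Suc (Suc m) div 2"
    "card {x. x < Suc m \<and> odd x} = Suc m div 2"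
    using Suc by auto
qed auto

lemma equitably_3_colorable_corona_path:
  assumes G: "pair_graph G" and n: "card (pverts G) \<ge> 2"
    and col: "equitably_colorable 3 G"
    and m: "m \<in> {2, 3, 5}"
  shows "equitably_colorable 3 (corona G (path_graph m))"
proof -
  let ?A = "pverts G" and ?C = "corona G (path_graph m)"
  have fin: "finite ?A"
    using G by (simp add: pair_graph_iff)
  obtain c :: "'a \<Rightarrow> nat" where c3: "\<forall>v\<in>?A. c v < 3" and cE: "\<forall>(u, v)\<in>parcs G. c u \<noteq> c v"
    and ceq: "\<forall>i<3. \<forall>j<3. card {v \<in> ?A. c v = i} \<le> Suc (card {v \<in> ?A. c v = j})"
    using col unfolding equitably_colorable_iff[OF G] by blast
  define s where "s i = card {v \<in> ?A. c v = i}" for i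
  have "?A = {v \<in> ?A. c v = 0} \<union> {v \<in> ?A. c v = 1} \<union> {v \<in> ?A. c v = 2}"
    using c3 by (auto simp: numeral_eq_Suc less_Suc_eq)
  moreover have "card \<dots> = s 0 + s 1 + s 2"
    unfolding s_def using fin by (subst card_Un_disjoint; (subst card_Un_disjoint)?) auto
  ultimately have total: "card ?A = s 0 + s 1 + s 2"
    by simp
  have near: "s i \<le> Suc (s j)" if "i < 3" "j < 3" for i j
    using ceq that by (simp add: s_def)
  \<comment> \<open>If this failed for some \<open>i < 3\<close>, then \<open>s i\<close> would
    exceed the sum of the other two sizes. As it exceeds each of them by at most 1, both would be 0,
    leaving at most one vertex.\<close>
  have half: "2 * s i \<le> card ?A" for i
  proof (cases "i < 3")
    case True
    then have "i = 0 \<or> i = 1 \<or> i = 2" by linarith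
    then show ?thesis
      using total n near[of 0 1] near[of 0 2] near[of 1 0] near[of 1 2] near[of 2 0] near[of 2 1]
      by auto
  next
    case False
    then have "{v \<in> ?A. c v = i} = {}" using c3 by auto
    then show ?thesis unfolding s_def by (simp only: card.empty)
  qed
  then obtain \<pi> where \<pi>: "bij_betw \<pi> ?A ?A" and neq: "\<forall>v\<in>?A. c (\<pi> v) \<noteq> c v"
    using ex_permutation_changing_values[OF fin, of c] unfolding s_def by blast
  define d where "d v = c (\<pi> v)" for v
  have d3: "d v < 3" "d v \<noteq> c v" if "v \<in> ?A" for v
    using that \<pi> c3 neq by (auto simp: d_def bij_betw_def)
  have card_d: "card {v \<in> ?A. d v = i} = s i" for i
  proof -
    have "\<pi> ` {v \<in> ?A. d v = i} = {v \<in> ?A. c v = i}"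
      using \<pi> by (auto simp: d_def bij_betw_def)
    then have "bij_betw \<pi> {v \<in> ?A. d v = i} {v \<in> ?A. c v = i}"
      using \<pi> by (auto simp: bij_betw_def intro: inj_on_subset)
    then show ?thesis
      unfolding s_def by (rule bij_betw_same_card)
  qed
  \<comment> \<open>The third colour is \<open>3 - c v - d v\<close>, since \<open>0 + 1 + 2 = 3\<close>.\<close>
  define t where "t v = 3 - c v - d v" for v
  define e where "e = (\<lambda>(v, y). case y of None \<Rightarrow> c v
    | Some (x :: nat) \<Rightarrow> if even x then d v else t v)"
  have third: "t v < 3" "t v \<noteq> c v" "t v \<noteq> d v"
    "i < 3 \<Longrightarrow> t v = i \<longleftrightarrow> i \<noteq> c v \<and> i \<noteq> d v" if "v \<in> ?A" for v i
  proof -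
    have "c v = 0 \<or> c v = 1 \<or> c v = 2" "d v = 0 \<or> d v = 1 \<or> d v = 2"
      using d3(1)[OF that] c3 that by fastforce+
    then show "t v < 3" "t v \<noteq> c v" "t v \<noteq> d v"
      "i < 3 \<Longrightarrow> t v = i \<longleftrightarrow> i \<noteq> c v \<and> i \<noteq> d v"
      using d3(2)[OF that] by (auto simp: t_def)
  qed
  have class_size: "card {w \<in> pverts ?C. e w = i} =
      s i + s i * (Suc m div 2) + (card ?A - 2 * s i) * (m div 2)" if "i < 3" for i
  proof -
    let ?C1 = "{v \<in> ?A. c v = i}" and ?D1 = "{v \<in> ?A. d v = i}"
    \<comment> \<open>Colour \<open>i\<close> on base vertices, on even and on odd path positions.
      Positions start at 0, so for odd \<open>m\<close> the even ones, coloured by \<open>d\<close>,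
      are one more than the odd ones.\<close>
    let ?X = "?C1 \<times> {None :: nat option}"
      and ?Y = "?D1 \<times> Some ` {x. x < m \<and> even x}"
      and ?Z = "(?A - (?C1 \<union> ?D1)) \<times> Some ` {x. x < m \<and> odd x}"
    have "{w \<in> pverts ?C. e w = i} = ?X \<union> ?Y \<union> ?Z"
      using third(4) third(2,3)[THEN not_sym] that
      by (auto simp: corona_def path_graph_def e_def split: if_splits)
    moreover have "finite ?X" "finite ?Y" "finite ?Z"
      using fin by auto
    moreover have "?X \<inter> ?Y = {}" "(?X \<union> ?Y) \<inter> ?Z = {}"
      by auto
    moreover have "card (?A - (?C1 \<union> ?D1)) = card ?A - 2 * s i"
    proof -
      have "?C1 \<inter> ?D1 = {}" using d3 by auto
      then have "card (?C1 \<union> ?D1) = 2 * s i"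
        using fin card_d[of i] by (simp add: card_Un_disjoint s_def)
      then show ?thesis
        using fin by (subst card_Diff_subset) auto
    qed
    ultimately show ?thesis
      using card_d[of i]
      by (simp add: card_Un_disjoint card_cartesian_product card_image card_even_less
          card_odd_less s_def)
  qed
  \<comment> \<open>For \<open>m\<close> = 2, 3, 5 the class sizes are \<open>card ?A\<close>,
    \<open>card ?A + s i\<close> and \<open>2 * card ?A\<close>; \<open>half\<close> makes the
    truncated subtraction exact.\<close>
  have "card {w \<in> pverts ?C. e w = i} \<le> Suc (card {w \<in> pverts ?C. e w = j})"
    if "i < 3" "j < 3" for i j
    using m half[of i] half[of j] near[OF that] class_size[OF that(1)] class_size[OF that(2)]
    by auto
  moreover have "\<forall>w\<in>pverts ?C. e w < 3"
    using c3 d3 third(1) by (auto simp: corona_def e_def)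
  moreover have "\<forall>(u, v)\<in>parcs ?C. e u \<noteq> e v"
  proof -
    have alt: "even x \<noteq> even y" if "(x, y) \<in> parcs (path_graph m)" for x y
      using that by (auto simp: path_graph_def)
    have "e (v, Some x) \<noteq> e (v, Some y)" if "v \<in> ?A" "(x, y) \<in> parcs (path_graph m)" for v x y
      using alt[OF that(2)] third(3)[OF that(1)] by (auto simp: e_def)
    moreover have "e (v, None) \<noteq> e (v, Some x)" if "v \<in> ?A" for v x
      using d3(2)[OF that] third(2)[OF that] by (auto simp: e_def)
    moreover have "e (u, None) \<noteq> e (v, None)" if "(u, v) \<in> parcs G" for u v
      using cE that by (auto simp: e_def)
    ultimately show ?thesis
      unfolding corona_def by (auto simp: eq_commute)
  qed
  ultimately show ?thesis
    unfolding equitably_colorable_iff[OF pair_graph_corona[OF G pair_graph_path_graph]]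
    by blast
qed

section \<open>Iteration and the lower bound\<close>

lemma equitably_3_colorable_iterated_corona_path:
  assumes "pair_graph G" "card (pverts G) \<ge> 2" "equitably_colorable 3 G" "m \<in> {2, 3, 5}"
  shows "equitably_colorable 3 (iterated_corona G l (path_graph m))"
proof (induction l)
  case 0
  show ?case
    using assms(3) by (auto intro!: equitably_colorable_relabel simp: inj_def)
next
  case (Suc l)
  \<comment> \<open>The extension asks for two vertices at every stage; a corona never has fewer
    vertices than its base.\<close>
  have "finite (pverts (path_graph m))" by (simp add: path_graph_def)
  then have "card (pverts (iterated_corona G l (path_graph m))) \<ge> card (pverts G)"
    by (simp add: card_iterated_corona)
  with Suc assms show ?case
    by (auto intro!: equitably_colorable_relabel inj_flatten equitably_3_colorable_corona_path
        pair_graph_iterated_corona pair_graph_path_graph)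
qed

theorem theorem7:
  fixes G :: "'a pair_pre_digraph" and n l m :: nat
  assumes "pair_graph G" and "Digraph_Component.connected (with_proj G)"
    and "card (pverts G) = n" and "n \<ge> 2"
    and "equitably_colorable 3 G"
    and "l \<ge> 1"
    and "m \<in> {2, 3, 5}"
  shows "equitable_chromatic_number (iterated_corona G l (path_graph m)) = 3"
  unfolding equitable_chromatic_number_def
proof (rule Least_equality)
  show "equitably_colorable 3 (iterated_corona G l (path_graph m))"
    using assms by (intro equitably_3_colorable_iterated_corona_path) auto
next
  fix k assume k: "equitably_colorable k (iterated_corona G l (path_graph m))"
  \<comment> \<open>As \<open>l\<close> is positive, the graph is a relabelled corona over
    \<open>?K\<close>. Any vertex of \<open>?K\<close> forms a triangle with the first two vertices
    of its path, and \<open>?f\<close>, the flattening map, preserves its arcs.\<close>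
  obtain l' where l: "l = Suc l'"
    using assms(6) by (cases l) auto
  let ?K = "iterated_corona G l' (path_graph m)"
  let ?f = "\<lambda>((v, ys), y). (v, y # ys) :: 'a \<times> nat option list"
  have "card (pverts ?K) > 0"
    using assms(3,4) by (subst card_iterated_corona) (auto simp: path_graph_def)
  then obtain v where v: "v \<in> pverts ?K"
    by (metis all_not_in_conv card.empty less_irrefl)
  have path: "0 \<in> pverts (path_graph m)" "1 \<in> pverts (path_graph m)" "(0, 1) \<in> parcs (path_graph m)"
    using assms(7) by (auto simp: path_graph_def)
  have arcs: "((v, None), (v, Some 0)) \<in> parcs (corona ?K (path_graph m))"
    "((v, Some 0), (v, Some 1)) \<in> parcs (corona ?K (path_graph m))"
    "((v, None), (v, Some 1)) \<in> parcs (corona ?K (path_graph m))"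
    using v path by (cases v; auto simp: corona_def)+
  have relabel_arc: "(?f x, ?f y) \<in> parcs (iterated_corona G l (path_graph m))"
    if "(x, y) \<in> parcs (corona ?K (path_graph m))" for x y
    using imageI[OF that, of "map_prod ?f ?f"] by (simp add: l relabel_def)
  show "3 \<le> k"
    using colors_ge_3_if_triangle[OF _ k relabel_arc[OF arcs(1)] relabel_arc[OF arcs(2)]
        relabel_arc[OF arcs(3)]] assms(1)
    by (simp add: pair_graph_iterated_corona pair_graph_path_graph)
qed

end
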